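(* The assignment $H|_C\mapsto\mathcal{E}$ is not injective. There exist $C^\infty$ functions $g_1,g_2$ on $C$ that are strictly convex and coercive along every leaf (i.e. for every $b=(q_2,p_2)\in\mathbb{R}^2$ the function $p_1\mapsto g_i(0,q_2,p_1,p_2)$ is strictly convex and tends to $+\infty$ as $|p_1|\to\infty$), that share the same fibrewise least-energy function $\mathcal{E}$ (hence have the same admissible region $A_E$ at every $E\in\mathbb{R}$), yet have different fibrewise level sets $\{p_1: g_1(0,q_2,p_1,p_2)=E\}\neq\{p_1: g_2(0,q_2,p_1,p_2)=E\}$ for some $b=(q_2,p_2)$ and $E$.
   Context: Coordinates on $\mathbb{R}^4$ are $(q_1,q_2,p_1,p_2)$; $C=\{q_1=0\}$; leaves of $C$ are the lines along which $(q_2,p_2)=b$ is fixed and $p_1$ varies. For a function $g=H|_C$ on $C$: its fibrewise least-energy function is $\mathcal{E}(b)=\inf_{p_1\in\mathbb{R}}g(0,q_2,p_1,p_2)$, and its admissible region at energy $E$ is $A_E=\{b=(q_2,p_2)\in\mathbb{R}^2:\exists\,p_1\in\mathbb{R},\ g(0,q_2,p_1,p_2)=E\}$. *)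

theory Defs
  imports "HOL-Analysis.Analysis"
begin

primrec cont_diff :: "nat \<Rightarrow> ('a::euclidean_space \<Rightarrow> 'b::euclidean_space) \<Rightarrow> bool" where
  "cont_diff 0 f \<longleftrightarrow> continuous_on UNIV f"
| "cont_diff (Suc k) f \<longleftrightarrow>
     (\<forall>x. f differentiable (at x)) \<and> (\<forall>v. cont_diff k (\<lambda>x. frechet_derivative f (at x) v))"

definition smooth :: "('a::euclidean_space \<Rightarrow> 'b::euclidean_space) \<Rightarrow> bool" where
  "smooth f \<longleftrightarrow> (\<forall>k. cont_diff k f)"

definition strictly_convex_on :: "'a::real_vector set \<Rightarrow> ('a \<Rightarrow> real) \<Rightarrow> bool" where
  "strictly_convex_on S f \<longleftrightarrow> convex S \<and>
     (\<forall>x\<in>S. \<forall>y\<in>S. \<forall>u>0. \<forall>v>0. x \<noteq> y \<and> u + v = 1 \<longrightarrow>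
        f (u *\<^sub>R x + v *\<^sub>R y) < u * f x + v * f y)"

text \<open>Points of phase space are tuples \<open>(q1, q2, p1, p2)\<close>. A point \<open>b = (q2, p2)\<close> labels the
  leaf \<open>{(0, q2, p1, p2) | p1}\<close> of \<open>C\<close>.\<close>

type_synonym phase = "real \<times> real \<times> real \<times> real"

definition C :: "phase set" where
  "C = {(q1, q2, p1, p2). q1 = 0}"

text \<open>Functions on \<open>C\<close> are represented as elements of \<open>extensional C\<close>, so that equality of
  representatives is equality on \<open>C\<close>. Smoothness is taken in the global chart \<open>(q2, p1, p2)\<close>
  of \<open>C\<close>.\<close>

definition smooth_functions_on_C :: "(phase \<Rightarrow> real) set" where
  "smooth_functions_on_C = {g \<in> extensional C. smooth (\<lambda>(q2, p1, p2). g (0, q2, p1, p2))}"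

definition strictly_convex_along_leaves :: "(phase \<Rightarrow> real) \<Rightarrow> bool" where
  "strictly_convex_along_leaves g \<longleftrightarrow>
     (\<forall>q2 p2. strictly_convex_on UNIV (\<lambda>p1. g (0, q2, p1, p2)))"

text \<open>On the reals, \<open>at_infinity\<close> is the filter of \<open>\<bar>p1\<bar>\<close> tending to infinity.\<close>

definition coercive_along_leaves :: "(phase \<Rightarrow> real) \<Rightarrow> bool" where
  "coercive_along_leaves g \<longleftrightarrow>
     (\<forall>q2 p2. filterlim (\<lambda>p1. g (0, q2, p1, p2)) at_top at_infinity)"

text \<open>The infimum is taken in the extended reals, so that it has its usual meaning also when
  \<open>g\<close> is unbounded below on a leaf.\<close>

definition least_energy :: "(phase \<Rightarrow> real) \<Rightarrow> real \<times> real \<Rightarrow> ereal" where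
  "least_energy g = (\<lambda>(q2, p2). INF p1. ereal (g (0, q2, p1, p2)))"

definition admissible_region :: "(phase \<Rightarrow> real) \<Rightarrow> real \<Rightarrow> (real \<times> real) set" where
  "admissible_region g E = {(q2, p2). \<exists>p1. g (0, q2, p1, p2) = E}"

definition leaf_level_set :: "(phase \<Rightarrow> real) \<Rightarrow> real \<times> real \<Rightarrow> real \<Rightarrow> real set" where
  "leaf_level_set g = (\<lambda>(q2, p2) E. {p1. g (0, q2, p1, p2) = E})"

end

theory Submission
  imports Defs
begin

text \<open>The infimum over a leaf sees only the minimum of the energy, not how fast the energy
  grows away from it. Take the energies \<open>c * p1^2\<close> with c = 1 and c = 2. On every leaf
  both are strictly convex and coercive with minimum 0 at p1 = 0, so
  \<open>least_energy_fibre_square\<close> gives the same function for both. Both take exactly the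
  values E >= 0, so the admissible regions agree (\<open>admissible_region_fibre_square\<close>).
  Yet p1 = 1 has energy 1 for the first and 2 for the second, so the level sets at E = 1 differ, and
  with them the functions on C. The same pair serves both halves of the claim: as restrictions of
  smooth functions on phase space, and as functions smooth in the chart of C.\<close>

lemma cont_diff_const: "cont_diff k (\<lambda>x. c)"
  by (induction k arbitrary: c) simp_all

text \<open>A linear map is its own derivative at every point, so its derivative in a fixed
  direction is constant in x.\<close>

lemma cont_diff_bounded_linear:
  assumes "bounded_linear f"
  shows "cont_diff k f"
proof (cases k)
  case 0
  then show ?thesis
    by (simp add: assms linear_continuous_on)
next
  case (Suc m)
  have d: "(f has_derivative f) (at x)" for x
    using assms by (rule bounded_linear_imp_has_derivative)
  then have "frechet_derivative f (at x) = f" for x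
    by (metis frechet_derivative_at)
  with d show ?thesis
    by (auto simp: Suc cont_diff_const differentiable_def)
qed

text \<open>The derivative in direction v is \<open>2 * c * l v * l x\<close>, again linear in x, so
  one differentiation reduces to the linear case and no induction on the order is needed. The form
  \<open>l\<close> is arbitrary because p1 is read off both on phase space and in the
  three-dimensional chart of C.\<close>

lemma smooth_scaled_square:
  fixes l :: "'a::euclidean_space \<Rightarrow> real"
  assumes "bounded_linear l"
  shows "smooth (\<lambda>x. c * (l x)\<^sup>2)"
  unfolding smooth_def
proof
  fix k
  let ?f = "\<lambda>x. c * (l x)\<^sup>2"
  have dl: "(l has_derivative l) (at x)" for x
    using assms by (rule bounded_linear_imp_has_derivative)
  have d: "(?f has_derivative (\<lambda>v. (2 * c * l v) * l x)) (at x)" for x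
    by (auto intro!: derivative_eq_intros dl simp: algebra_simps)
  then have f': "frechet_derivative ?f (at x) = (\<lambda>v. (2 * c * l v) * l x)" for x
    by (metis frechet_derivative_at)
  show "cont_diff k ?f"
  proof (cases k)
    case 0
    then show ?thesis
      by (simp add: assms linear_continuous_on continuous_intros)
  next
    case (Suc m)
    have "cont_diff m (\<lambda>x. (2 * c * l v) * l x)" for v
      by (intro cont_diff_bounded_linear bounded_linear_const_mult assms)
    with d show ?thesis
      unfolding Suc cont_diff.simps f' differentiable_def by blast
  qed
qed

lemma strictly_convex_on_scaled_square:
  fixes c :: real
  assumes "c > 0"
  shows "strictly_convex_on UNIV (\<lambda>x. c * x\<^sup>2)"
  unfolding strictly_convex_on_def
proof (intro conjI ballI allI impI)
  fix x y u v :: real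
  assume "u > 0" "v > 0" and xy: "x \<noteq> y \<and> u + v = 1"
  \<comment> \<open>For u + v = 1 this is exactly the gap in the convexity inequality.\<close>
  then have "0 < c * (u * v * (x - y)\<^sup>2)"
    using assms by simp
  also have "\<dots> = u * (c * x\<^sup>2) + v * (c * y\<^sup>2) - c * (u * x + v * y)\<^sup>2"
  proof -
    have v: "v = 1 - u"
      using xy by simp
    show ?thesis
      unfolding v by (simp add: power2_eq_square algebra_simps)
  qed
  finally show "c * (u *\<^sub>R x + v *\<^sub>R y)\<^sup>2 < u * (c * x\<^sup>2) + v * (c * y\<^sup>2)"
    by simp
qed simp

lemma filterlim_scaled_square_at_infinity:
  fixes c :: real
  assumes "c > 0"
  shows "filterlim (\<lambda>x. c * x\<^sup>2) at_top at_infinity"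
proof -
  have "filterlim (\<lambda>x::real. (norm x)\<^sup>2) at_top at_infinity"
    by (intro filterlim_pow_at_top filterlim_norm_at_top) simp
  then show ?thesis
    using assms by (intro filterlim_tendsto_pos_mult_at_top[OF tendsto_const]) simp_all
qed

text \<open>Defined on all of phase space, so that it is the smooth H whose restriction to C is
  required.\<close>

definition fibre_square :: "real \<Rightarrow> phase \<Rightarrow> real" where
  "fibre_square c = (\<lambda>(q1, q2, p1, p2). c * p1\<^sup>2)"

lemma smooth_fibre_square: "smooth (fibre_square c)"
proof -
  have "bounded_linear (\<lambda>x::phase. fst (snd (snd x)))"
    by (intro bounded_linear_intros)
  from smooth_scaled_square[OF this] show ?thesis
    by (simp add: fibre_square_def case_prod_unfold)
qed

lemma leaf_in_C [simp]: "(0, q2, p1, p2) \<in> C"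
  by (simp add: C_def)

lemma fibre_square_apply [simp]: "fibre_square c (q1, q2, p1, p2) = c * p1\<^sup>2"
  by (simp add: fibre_square_def)

lemma restrict_fibre_square_smooth_on_C:
  "restrict (fibre_square c) C \<in> smooth_functions_on_C"
proof -
  have "bounded_linear (\<lambda>x::real \<times> real \<times> real. fst (snd x))"
    by (intro bounded_linear_intros)
  from smooth_scaled_square[OF this] show ?thesis
    by (simp add: smooth_functions_on_C_def C_def fibre_square_def case_prod_unfold)
qed

lemma fibre_square_strictly_convex_along_leaves:
  "c > 0 \<Longrightarrow> strictly_convex_along_leaves (restrict (fibre_square c) C)"
  by (simp add: strictly_convex_along_leaves_def strictly_convex_on_scaled_square)

lemma fibre_square_coercive_along_leaves:
  "c > 0 \<Longrightarrow> coercive_along_leaves (restrict (fibre_square c) C)"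
  by (simp add: coercive_along_leaves_def filterlim_scaled_square_at_infinity)

lemma least_energy_fibre_square:
  assumes "c > 0"
  shows "least_energy (restrict (fibre_square c) C) = (\<lambda>b. 0)"
proof -
  have "(INF p. ereal (c * p\<^sup>2)) = 0"
  proof (rule antisym)
    show "(INF p. ereal (c * p\<^sup>2)) \<le> 0"
      \<comment> \<open>The infimum is attained at momentum 0, whatever c is.\<close>
      by (rule INF_lower2[of 0]) simp_all
    show "0 \<le> (INF p. ereal (c * p\<^sup>2))"
      using assms by (intro INF_greatest) simp
  qed
  then show ?thesis
    by (simp add: least_energy_def case_prod_unfold)
qed

lemma admissible_region_fibre_square:
  assumes "c > 0"
  shows "admissible_region (restrict (fibre_square c) C) E = {b. E \<ge> 0}"
proof -
  have "(\<exists>p. c * p\<^sup>2 = E) \<longleftrightarrow> E \<ge> 0"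
  proof
    assume "E \<ge> 0"
    then have "c * (sqrt (E / c))\<^sup>2 = E"
      using assms by simp
    then show "\<exists>p. c * p\<^sup>2 = E" ..
  qed (use assms in auto)
  then show ?thesis
    by (simp add: admissible_region_def)
qed

theorem proposition3p2:
  shows "\<not> inj_on least_energy
           {restrict H C | H :: phase \<Rightarrow> real. smooth H \<and>
              strictly_convex_along_leaves (restrict H C) \<and>
              coercive_along_leaves (restrict H C)}
       \<and> (\<exists>g1 \<in> smooth_functions_on_C. \<exists>g2 \<in> smooth_functions_on_C.
            strictly_convex_along_leaves g1 \<and> coercive_along_leaves g1 \<and>
            strictly_convex_along_leaves g2 \<and> coercive_along_leaves g2 \<and>
            least_energy g1 = least_energy g2 \<and>
            (\<forall>E. admissible_region g1 E = admissible_region g2 E) \<and>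
            (\<exists>b E. leaf_level_set g1 b E \<noteq> leaf_level_set g2 b E))"
proof -
  define g1 where "g1 = restrict (fibre_square 1) C"
  define g2 where "g2 = restrict (fibre_square 2) C"
  let ?A = "{restrict H C | H :: phase \<Rightarrow> real. smooth H \<and>
              strictly_convex_along_leaves (restrict H C) \<and>
              coercive_along_leaves (restrict H C)}"
  have convex: "strictly_convex_along_leaves g1" "strictly_convex_along_leaves g2"
    and coercive: "coercive_along_leaves g1" "coercive_along_leaves g2"
    by (simp_all add: g1_def g2_def fibre_square_strictly_convex_along_leaves
        fibre_square_coercive_along_leaves)
  have energy: "least_energy g1 = least_energy g2"
    by (simp add: g1_def g2_def least_energy_fibre_square)
  have region: "\<forall>E. admissible_region g1 E = admissible_region g2 E"
    by (simp add: g1_def g2_def admissible_region_fibre_square)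
  \<comment> \<open>Neither energy depends on the leaf, so b = (0, 0) is an arbitrary choice; at
    energy 1 the level sets are p1 = 1, -1 for \<open>g1\<close> and p1 = 1/sqrt 2, -1/sqrt 2 for
    \<open>g2\<close>.\<close>
  have "1 \<in> leaf_level_set g1 (0, 0) 1" "1 \<notin> leaf_level_set g2 (0, 0) 1"
    by (simp_all add: leaf_level_set_def g1_def g2_def)
  then have level: "leaf_level_set g1 (0, 0) 1 \<noteq> leaf_level_set g2 (0, 0) 1"
    by blast
  have "g1 \<in> ?A" "g2 \<in> ?A"
    using convex coercive smooth_fibre_square unfolding g1_def g2_def by blast+
  \<comment> \<open>Equal functions would have equal level sets.\<close>
  moreover have "g1 \<noteq> g2"
    using level by auto
  ultimately have "\<not> inj_on least_energy ?A"
    using energy by (meson inj_onD)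
  moreover have "g1 \<in> smooth_functions_on_C" "g2 \<in> smooth_functions_on_C"
    by (simp_all add: g1_def g2_def restrict_fibre_square_smooth_on_C)
  ultimately show ?thesis
    using convex coercive energy region level by blast
qed

end
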